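(* The maps $C:\mathcal{M}^{\mathrm{CP}}_{\mathbb{Z}}\to\mathbb{Z}_{\leq 4}$ and $C:\widehat{\mathcal{S}}^{\mathrm{CP}}\to\mathbb{Z}_{\leq 4}$ are surjective.
   Context: $\mathcal{M}$ is the set of real $2\times 3$ arrays $M=\begin{pmatrix} x & y & z\\ x' & y' & z'\end{pmatrix}$ with $xyz=x'y'z'$ and each column's two entries of the same sign (encoding the skew-symmetrizable matrix $\begin{pmatrix}0&-z'&y\\ z&0&-x'\\ -y'&x&0\end{pmatrix}$). The transformations are $\gamma_1(M)=\begin{pmatrix} y'z'-x & y & z\\ yz-x' & y' & z'\end{pmatrix}$, $\gamma_2(M)=\begin{pmatrix} x & z'x'-y & z\\ x' & zx-y' & z'\end{pmatrix}$, $\gamma_3(M)=\begin{pmatrix} x & y & x'y'-z\\ x' & y' & xy-z'\end{pmatrix}$, and on triples $S=(p,q,r)\in\mathbb{R}^3$: $\gamma_1(p,q,r)=(qr-p,q,r)$, $\gamma_2(p,q,r)=(p,rp-q,r)$, $\gamma_3(p,q,r)=(p,q,pq-r)$. $\Gamma(M)$ (resp. $\Gamma(S)$) is the set of all images under finite compositions of the $\gamma_k$ with consecutive indices distinct; a positive element is cluster-positive if every element of its orbit has all entries positive. $\mathcal{M}^{\mathrm{CP}}_{\mathbb{Z}}$ is the set of cluster-positive elements of $\mathcal{M}$ with integer entries. $\mathrm{Sk}(M)=(\varepsilon_x\sqrt{xx'},\varepsilon_y\sqrt{yy'},\varepsilon_z\sqrt{zz'})$, where $\varepsilon_a$ is the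 sign of $a$, and $\widehat{\mathcal{S}}^{\mathrm{CP}}=\mathrm{Sk}(\mathcal{M}^{\mathrm{CP}}_{\mathbb{Z}})$. The Markov constants are $C(M)=xx'+yy'+zz'-xyz$ and $C(p,q,r)=p^2+q^2+r^2-pqr$. *)

theory Defs
  imports Complex_Main
begin

type_synonym triple = "real \<times> real \<times> real"

text \<open>The pair \<open>((x, y, z), (x', y', z'))\<close> of rows is the \<open>2 \<times> 3\<close> array that encodes the
  skew-symmetrizable matrix with rows \<open>(0, -z', y)\<close>, \<open>(z, 0, -x')\<close>, \<open>(-y', x, 0)\<close>.\<close>

type_synonym array = "triple \<times> triple"

text \<open>A column \<open>(0, 0)\<close> counts as having entries of the same sign.\<close>

definition arrays :: "array set" where
  "arrays = {((x, y, z), (x', y', z')) | x y z x' y' z'.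
     x * y * z = x' * y' * z' \<and> sgn x = sgn x' \<and> sgn y = sgn y' \<and> sgn z = sgn z'}"

datatype index = I1 | I2 | I3

fun gamma :: "index \<Rightarrow> array \<Rightarrow> array" where
  "gamma I1 ((x, y, z), (x', y', z')) = ((y' * z' - x, y, z), (y * z - x', y', z'))"
| "gamma I2 ((x, y, z), (x', y', z')) = ((x, z' * x' - y, z), (x', z * x - y', z'))"
| "gamma I3 ((x, y, z), (x', y', z')) = ((x, y, x' * y' - z), (x', y', x * y - z'))"

text \<open>The empty composition is included, so \<open>M\<close> belongs to its own orbit.\<close>

definition orbit :: "array \<Rightarrow> array set" where
  "orbit M = {fold gamma ks M | ks. distinct_adj ks}"

fun positive :: "array \<Rightarrow> bool" where
  "positive ((x, y, z), (x', y', z')) \<longleftrightarrow>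
     x > 0 \<and> y > 0 \<and> z > 0 \<and> x' > 0 \<and> y' > 0 \<and> z' > 0"

definition cluster_positive :: "array \<Rightarrow> bool" where
  "cluster_positive M \<longleftrightarrow> positive M \<and> (\<forall>N \<in> orbit M. positive N)"

fun integral_entries :: "array \<Rightarrow> bool" where
  "integral_entries ((x, y, z), (x', y', z')) \<longleftrightarrow>
     x \<in> \<int> \<and> y \<in> \<int> \<and> z \<in> \<int> \<and> x' \<in> \<int> \<and> y' \<in> \<int> \<and> z' \<in> \<int>"

definition M_CP_Z :: "array set" where
  "M_CP_Z = {M \<in> arrays. cluster_positive M \<and> integral_entries M}"

fun Sk :: "array \<Rightarrow> triple" where
  "Sk ((x, y, z), (x', y', z')) =
     (sgn x * sqrt (x * x'), sgn y * sqrt (y * y'), sgn z * sqrt (z * z'))"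

definition S_hat_CP :: "triple set" where
  "S_hat_CP = Sk ` M_CP_Z"

fun markov_array :: "array \<Rightarrow> real" where
  "markov_array ((x, y, z), (x', y', z')) = x * x' + y * y' + z * z' - x * y * z"

fun markov_triple :: "triple \<Rightarrow> real" where
  "markov_triple (p, q, r) = p\<^sup>2 + q\<^sup>2 + r\<^sup>2 - p * q * r"

end

theory Submission
  imports Defs
begin

text \<open>With \<open>(p, q, r) = Sk M\<close>, the constant \<open>C\<close> is invariant under mutation. An element of a
  cluster-positive integral orbit that minimises \<open>xx' + yy' + zz'\<close> satisfies \<open>2p \<le> qr\<close>,
  \<open>2q \<le> pr\<close> and \<open>2r \<le> pq\<close>, and these inequalities force \<open>C \<le> 4\<close>. Conversely, the
  conditions \<open>p, q, r \<ge> 2\<close> and \<open>C \<le> 4\<close> are preserved by mutation and keep the entries positive;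
  the array with rows \<open>(w, 1, 3)\<close> and \<open>(1, w, 3)\<close>, where \<open>w \<ge> 5\<close>, satisfies them and has
  \<open>C = 9 - w\<close>.\<close>

section \<open>Orbits\<close>

lemma gamma_involution: "gamma k (gamma k M) = M"
proof -
  obtain x y z x' y' z' where "M = ((x, y, z), (x', y', z'))"
    by (metis prod.exhaust)
  then show ?thesis
    by (cases k) (simp_all add: algebra_simps)
qed

lemma self_in_orbit: "M \<in> orbit M"
  unfolding orbit_def by (force intro: exI[of _ "[]"])

text \<open>Appending an index equal to the last one would break \<open>distinct_adj\<close>; in
  that case the involution cancels it, and the shortened word serves instead.\<close>

lemma gamma_in_orbit:
  assumes "N \<in> orbit M"
  shows "gamma k N \<in> orbit M"
proof -
  obtain ks where N: "N = fold gamma ks M" and ks: "distinct_adj ks"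
    using assms unfolding orbit_def by blast
  consider "ks = [] \<or> last ks \<noteq> k" | js where "ks = js @ [k]"
    by (metis append_butlast_last_id)
  then show ?thesis
  proof cases
    case 1
    then have "distinct_adj (ks @ [k])"
      using ks by (auto simp: distinct_adj_append_iff)
    moreover have "gamma k N = fold gamma (ks @ [k]) M"
      by (simp add: N)
    ultimately show ?thesis
      unfolding orbit_def by blast
  next
    case (2 js)
    then have "distinct_adj js"
      using ks by (auto simp: distinct_adj_append_iff)
    moreover have "gamma k N = fold gamma js M"
      by (simp add: N 2 gamma_involution)
    ultimately show ?thesis
      unfolding orbit_def by blast
  qed
qed

lemma orbit_invariant:
  assumes "N \<in> orbit M" and "P M" and "\<And>k N. P N \<Longrightarrow> P (gamma k N)"
  shows "P N"
proof -
  have "P (fold gamma ks L)" if "P L" for ks L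
    using that by (induction ks arbitrary: L) (simp_all add: assms(3))
  then show ?thesis
    using assms(1,2) unfolding orbit_def by blast
qed

fun balanced :: "array \<Rightarrow> bool" where
  "balanced ((x, y, z), (x', y', z')) \<longleftrightarrow> x * y * z = x' * y' * z'"

lemma balanced_gamma: "balanced M \<Longrightarrow> balanced (gamma k M)"
  by (cases "(k, M)" rule: gamma.cases) (auto simp: algebra_simps)

text \<open>For \<open>I1\<close>, expanding
  \<open>(y' * z' - x) * (y * z - x') - (y' * z' - x) * y * z\<close> leaves
  \<open>x * x' - x' * y' * z'\<close>, where balance restores \<open>x * y * z\<close>; the other
  indices are cyclic.\<close>

lemma markov_array_gamma: "balanced M \<Longrightarrow> markov_array (gamma k M) = markov_array M"
  by (cases "(k, M)" rule: gamma.cases) (auto simp: algebra_simps)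

lemma integral_entries_gamma: "integral_entries M \<Longrightarrow> integral_entries (gamma k M)"
  by (cases "(k, M)" rule: gamma.cases) auto

section \<open>The upper bound\<close>

lemma markov_le_4_ordered:
  fixes p q r :: real
  assumes "2 \<le> r" and "r \<le> q" and "q \<le> p" and "2 * p \<le> q * r"
  shows "p\<^sup>2 + q\<^sup>2 + r\<^sup>2 - p * q * r \<le> 4"
proof -
  \<comment> \<open>These express C(p,q,r) \<le> C(q,q,r) \<le> C(r,r,r) \<le> 4; their slacks sum
    to 4 - C(p,q,r). The first uses q * r \<ge> 2 * p \<ge> p + q.\<close>
  have "(p - q) * (q * r - p - q) \<ge> 0" "q\<^sup>2 * (r - 2) \<ge> r\<^sup>2 * (r - 2)"
    "(r - 2)\<^sup>2 * (r + 1) \<ge> 0"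
    using assms by (auto intro!: mult_right_mono mult_nonneg_nonneg)
  then show ?thesis
    by (simp add: algebra_simps power2_eq_square)
qed

lemma markov_le_4:
  fixes p q r :: real
  assumes pos: "p > 0" "q > 0" "r > 0"
    and le: "2 * p \<le> q * r" "2 * q \<le> r * p" "2 * r \<le> p * q"
  shows "p\<^sup>2 + q\<^sup>2 + r\<^sup>2 - p * q * r \<le> 4"
proof -
  \<comment> \<open>Chaining the two inequalities gives 4 * a \<le> a * c^2, and a > 0
    cancels.\<close>
  have ge2: "c \<ge> 2" if "a > 0" "b > 0" "c > 0" "2 * a \<le> b * c" "2 * b \<le> c * a" for a b c :: real
  proof -
    have "2 * (2 * a) \<le> 2 * b * c"
      using that by linarith
    also have "\<dots> \<le> c * a * c"
      using that by (intro mult_right_mono) auto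
    finally have "2\<^sup>2 \<le> c\<^sup>2"
      using that(1) by (simp add: power2_eq_square mult.commute mult.left_commute)
    then show ?thesis
      by (rule power2_le_imp_le) (use that in simp)
  qed
  have ge: "p \<ge> 2" "q \<ge> 2" "r \<ge> 2"
    using ge2[of q r p] ge2[of r p q] ge2[of p q r] assms by auto
  consider "r \<le> q \<and> q \<le> p" | "q \<le> r \<and> r \<le> p" | "r \<le> p \<and> p \<le> q"
    | "p \<le> r \<and> r \<le> q" | "p \<le> q \<and> q \<le> r" | "q \<le> p \<and> p \<le> r"
    by linarith
  then show ?thesis
    using markov_le_4_ordered[of r q p] markov_le_4_ordered[of q r p] markov_le_4_ordered[of r p q]
      markov_le_4_ordered[of p r q] markov_le_4_ordered[of p q r] markov_le_4_ordered[of q p r] le ge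
    by cases (simp_all add: ac_simps)
qed

text \<open>Under one root the product is (x * y * z)^2. This identifies the cubic terms of the two
  Markov constants.\<close>

lemma sqrt_product:
  fixes x y z x' y' z' :: real
  assumes "x * y * z = x' * y' * z'" and "x * y * z \<ge> 0"
  shows "sqrt (x * x') * sqrt (y * y') * sqrt (z * z') = x * y * z"
proof -
  have "sqrt (x * x') * sqrt (y * y') * sqrt (z * z') = sqrt ((x * y * z) * (x' * y' * z'))"
    by (simp add: real_sqrt_mult ac_simps)
  then show ?thesis
    using assms by simp
qed

lemma markov_triple_Sk:
  assumes "positive M" and "balanced M"
  shows "markov_triple (Sk M) = markov_array M"
proof -
  obtain x y z x' y' z' where M: "M = ((x, y, z), (x', y', z'))"
    by (metis prod.exhaust)
  show ?thesis
    using assms sqrt_product[of x y z x' y' z'] by (simp add: M)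
qed

fun weight :: "array \<Rightarrow> real" where
  "weight ((x, y, z), (x', y', z')) = x * x' + y * y' + z * z'"

lemma double_sqrt_le:
  fixes a b d k :: real
  assumes "a > 0" "b > 0" "d > 0" and k: "sqrt a * sqrt b * sqrt d = k"
    and "2 * k \<le> b * d"
  shows "2 * sqrt a \<le> sqrt b * sqrt d"
proof -
  \<comment> \<open>The left side equals \<open>2 * k\<close> and the right side
    \<open>b * d\<close>.\<close>
  have "(2 * sqrt a) * (sqrt b * sqrt d) \<le> (sqrt b * sqrt d) * (sqrt b * sqrt d)"
    using assms by (simp add: ac_simps)
  then show ?thesis
    using assms by (simp add: mult_le_cancel_right)
qed

lemma markov_le_4_minimal:
  assumes pos: "positive M" and bal: "balanced M"
    and min: "\<And>k. weight M \<le> weight (gamma k M)"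
  shows "markov_array M \<le> 4"
proof -
  obtain x y z x' y' z' where M: "M = ((x, y, z), (x', y', z'))"
    by (metis prod.exhaust)
  define k where "k = x * y * z"
  define a b d where "a = x * x'" and "b = y * y'" and "d = z * z'"
  note abd = a_def b_def d_def
  have gt0: "a > 0" "b > 0" "d > 0"
    using pos by (auto simp: M abd)
  have k: "sqrt a * sqrt b * sqrt d = k"
    using pos bal sqrt_product[of x y z x' y' z'] by (simp add: M abd k_def)
  have k': "x' * y' * z' = k"
    using bal by (simp add: M k_def)
  \<comment> \<open>Mutation at \<open>I1\<close> alters only the first column and changes the
    weight by \<open>b * d - 2 * k\<close>.\<close>
  have "2 * k \<le> b * d"
    using min[of I1] k' by (simp add: M abd k_def algebra_simps)
  moreover have "2 * k \<le> d * a"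
    using min[of I2] k' by (simp add: M abd k_def algebra_simps)
  moreover have "2 * k \<le> a * b"
    using min[of I3] k' by (simp add: M abd k_def algebra_simps)
  ultimately have "(sqrt a)\<^sup>2 + (sqrt b)\<^sup>2 + (sqrt d)\<^sup>2 - sqrt a * sqrt b * sqrt d \<le> 4"
    using gt0 k double_sqrt_le[of a b d k] double_sqrt_le[of b d a k] double_sqrt_le[of d a b k]
    by (intro markov_le_4) (simp_all add: ac_simps)
  then show ?thesis
    using gt0 k by (simp add: M abd k_def)
qed

lemma M_CP_Z_balanced: "M \<in> M_CP_Z \<Longrightarrow> balanced M"
  by (auto simp: M_CP_Z_def arrays_def)

lemma M_CP_Z_markov_le_4:
  assumes "M \<in> M_CP_Z"
  shows "markov_array M \<le> 4"
proof -
  let ?P = "\<lambda>N. balanced N \<and> integral_entries N \<and> markov_array N = markov_array M"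
  have P: "?P N" if "N \<in> orbit M" for N
  proof (rule orbit_invariant[OF that])
    show "?P M"
      using assms M_CP_Z_balanced by (auto simp: M_CP_Z_def)
  qed (simp add: balanced_gamma integral_entries_gamma markov_array_gamma)
  have pos: "positive N" if "N \<in> orbit M" for N
    using assms that by (auto simp: M_CP_Z_def cluster_positive_def)
  \<comment> \<open>On this orbit the weights are natural numbers, so a least one exists.\<close>
  have weight: "weight N = real (nat \<lfloor>weight N\<rfloor>)" if "N \<in> orbit M" for N
  proof -
    obtain x y z x' y' z' where N: "N = ((x, y, z), (x', y', z'))"
      by (metis prod.exhaust)
    have "weight N \<in> \<int>"
      using P[OF that] by (simp add: N)
    moreover have "weight N \<ge> 0"
      using pos[OF that] by (simp add: N)
    ultimately show ?thesis
      by (auto elim!: Ints_cases)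
  qed
  obtain N where N: "N \<in> orbit M"
    and min: "\<And>L. L \<in> orbit M \<Longrightarrow> nat \<lfloor>weight N\<rfloor> \<le> nat \<lfloor>weight L\<rfloor>"
    using ex_has_least_nat[of "\<lambda>N. N \<in> orbit M" M "\<lambda>N. nat \<lfloor>weight N\<rfloor>"] self_in_orbit by blast
  have "weight N \<le> weight (gamma k N)" for k
    using min gamma_in_orbit N weight by (metis of_nat_le_iff)
  then have "markov_array N \<le> 4"
    using N P pos by (intro markov_le_4_minimal) auto
  then show ?thesis
    using P[OF N] by simp
qed

section \<open>Arrays with positive orbit\<close>

text \<open>For positive arrays, this says that all entries of \<open>Sk M\<close> are at least
  2.\<close>

fun large :: "array \<Rightarrow> bool" where
  "large ((x, y, z), (x', y', z')) \<longleftrightarrow> x * x' \<ge> 4 \<and> y * y' \<ge> 4 \<and> z * z' \<ge> 4"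

text \<open>Two large columns contribute at least 8 > 4 to C, so \<open>x * x'\<close> lies below
  \<open>x * y * z\<close>, which is also \<open>x' * y' * z'\<close>; cancel \<open>x\<close> or
  \<open>x'\<close>.\<close>

lemma mutation_positive:
  fixes x y z x' y' z' :: real
  assumes pos: "x > 0" "y > 0" "z > 0" "x' > 0" "y' > 0" "z' > 0"
    and bal: "x * y * z = x' * y' * z'"
    and large: "y * y' \<ge> 4" "z * z' \<ge> 4"
    and C: "x * x' + y * y' + z * z' - x * y * z \<le> 4"
  shows "y' * z' - x > 0" and "y * z - x' > 0"
proof -
  have "x * x' < x * y * z"
    using large C by linarith
  then have "x * x' < x * (y * z)" "x' * x < x' * (y' * z')"
    using bal by (simp_all add: ac_simps)
  then show "y' * z' - x > 0" "y * z - x' > 0"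
    using pos by (auto simp: mult_less_cancel_left_pos)
qed

lemma column_ge_4:
  fixes x y z x' y' z' :: real
  assumes pos: "x > 0" "y > 0" "z > 0" "x' > 0" "y' > 0" "z' > 0"
    and bal: "x * y * z = x' * y' * z'"
    and large: "y * y' \<ge> 4" "z * z' \<ge> 4"
    and C: "x * x' + y * y' + z * z' - x * y * z \<le> 4"
  shows "x * x' \<ge> 4"
proof (rule ccontr)
  define p q r where "p = sqrt (x * x')" and "q = sqrt (y * y')" and "r = sqrt (z * z')"
  assume "\<not> x * x' \<ge> 4"
  then have "p < 2"
    using real_sqrt_less_iff[of "x * x'" 4] by (simp add: p_def)
  have ge2: "q \<ge> 2" "r \<ge> 2"
    using large real_sqrt_le_iff[of 4] by (auto simp: q_def r_def)
  then have "2 * 2 \<le> q * r"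
    by (intro mult_mono) auto
  \<comment> \<open>Adding (q - r)^2 to this product gives exactly C - 4, contradicting C \<le>
    4.\<close>
  then have "(2 - p) * (q * r - p - 2) > 0"
    using \<open>p < 2\<close> by (intro mult_pos_pos) auto
  moreover have "(q - r)\<^sup>2 \<ge> 0"
    by simp
  moreover have "p\<^sup>2 + q\<^sup>2 + r\<^sup>2 - p * q * r \<le> 4"
    using C pos sqrt_product[OF bal] by (simp add: p_def q_def r_def)
  ultimately show False
    by (simp add: algebra_simps power2_eq_square)
qed

definition dominant :: "array \<Rightarrow> bool" where
  "dominant M \<longleftrightarrow> positive M \<and> balanced M \<and> large M \<and> markov_array M \<le> 4"

text \<open>Mutation keeps two columns and C, so \<open>column_ge_4\<close> applied to the mutated
  array recovers the bound on the new column.\<close>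

lemma dominant_gamma:
  assumes "dominant M"
  shows "dominant (gamma k M)"
proof -
  obtain x y z x' y' z' where M: "M = ((x, y, z), (x', y', z'))"
    by (metis prod.exhaust)
  have bal: "balanced (gamma k M)" and C: "markov_array (gamma k M) \<le> 4"
    using assms balanced_gamma markov_array_gamma by (auto simp: dominant_def)
  have pos: "positive (gamma k M)"
    using assms mutation_positive[of x y z x' y' z'] mutation_positive[of y z x y' z' x']
      mutation_positive[of z x y z' x' y']
    by (cases k) (simp_all add: dominant_def M ac_simps)
  have "large (gamma k M)"
  proof (cases k)
    case I1
    then show ?thesis
      using assms bal C pos column_ge_4[of "y' * z' - x" y z "y * z - x'" y' z']
      by (simp add: dominant_def M)
  next
    case I2
    then show ?thesis
      using assms bal C pos column_ge_4[of "z' * x' - y" z x "z * x - y'" z' x']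
      by (simp add: dominant_def M ac_simps)
  next
    case I3
    then show ?thesis
      using assms bal C pos column_ge_4[of "x' * y' - z" x y "x * y - z'" x' y']
      by (simp add: dominant_def M ac_simps)
  qed
  then show ?thesis
    using bal C pos by (simp add: dominant_def)
qed

lemma cluster_positive_if_dominant:
  assumes "dominant M"
  shows "cluster_positive M"
proof -
  have "dominant N" if "N \<in> orbit M" for N
    using that assms dominant_gamma by (rule orbit_invariant)
  then show ?thesis
    using assms by (auto simp: cluster_positive_def dominant_def)
qed

lemma markov_array_attained:
  assumes "c \<in> \<int>" and "c \<le> 4"
  shows "\<exists>M \<in> M_CP_Z. markov_array M = c"
proof
  \<comment> \<open>The column products are \<open>9 - c\<close>, \<open>9 - c\<close> and 9, with
    \<open>9 - c\<close> \<ge> 5, and the cubic term is \<open>3 * (9 - c)\<close>.\<close>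
  let ?M = "((9 - c, 1, 3), (1, 9 - c, 3)) :: array"
  show "markov_array ?M = c"
    by simp
  have "dominant ?M"
    using assms by (simp add: dominant_def)
  then show "?M \<in> M_CP_Z"
    using assms cluster_positive_if_dominant by (auto simp: M_CP_Z_def arrays_def)
qed

theorem theorem9p12:
  shows "markov_array ` M_CP_Z = {c. c \<in> \<int> \<and> c \<le> 4} \<and>
    markov_triple ` S_hat_CP = {c. c \<in> \<int> \<and> c \<le> 4}"
proof -
  have "markov_array M \<in> \<int>" if "M \<in> M_CP_Z" for M
  proof -
    obtain x y z x' y' z' where M: "M = ((x, y, z), (x', y', z'))"
      by (metis prod.exhaust)
    show ?thesis
      using that by (simp add: M M_CP_Z_def)
  qed
  then have image: "markov_array ` M_CP_Z = {c. c \<in> \<int> \<and> c \<le> 4}"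
    using M_CP_Z_markov_le_4 markov_array_attained by fast
  \<comment> \<open>\<open>Sk\<close> preserves C, so the claim for triples reduces to that for
    arrays.\<close>
  have "markov_triple (Sk M) = markov_array M" if "M \<in> M_CP_Z" for M
    using that M_CP_Z_balanced
    by (intro markov_triple_Sk) (auto simp: M_CP_Z_def cluster_positive_def)
  then have "markov_triple ` S_hat_CP = markov_array ` M_CP_Z"
    by (simp add: S_hat_CP_def image_image)
  with image show ?thesis
    by simp
qed

end
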